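(* Let $V$ be a Hilbert space over $\mathbb{K}=\mathbb{R}$ or $\mathbb{C}$, let $A_0$ be a densely defined skew-symmetric operator on $V$, let $A:=-A_0^*$, and let $(H_-,H_+,G_-,G_+)$ be a boundary quadruple for $A_0$. Then the spaces $H_-=G_-D(A)$ and $H_+=G_+D(A)$ are complete.
   Context: Inner products are linear in the first argument (and conjugate-linear in the second if $\mathbb{K}=\mathbb{C}$). An operator on $V$ is a linear map defined on a linear subspace (its domain) of $V$ with values in $V$. $A_0$ is skew-symmetric if $\langle A_0u,v\rangle_V+\langle u,A_0v\rangle_V=0$ for all $u,v\in D(A_0)$. With $A:=-A_0^*$, $D(A)=D(A_0^* )$, one has $A_0\subset A$. A boundary quadruple $(H_-,H_+,G_-,G_+)$ for $A_0$ consists of pre-Hilbert spaces $H_-,H_+$ over $\mathbb{K}$ (completeness is not assumed) and surjective linear maps $G_-:D(A)\to H_-$, $G_+:D(A)\to H_+$ (continuity is not assumed) such that $\langle Au,v\rangle_V+\langle u,Av\rangle_V=\langle G_+u,G_+v\rangle_{H_+}-\langle G_-u,G_-v\rangle_{H_-}$ for all $u,v\in D(A)$, and $\ker G_-+\ker G_+=D(A)$. *)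

theory Defs
  imports "HOL-Analysis.Analysis"
begin

text \<open>
  The scalar field is either the reals or the complex numbers. By the Gelfand--Mazur theorem
  (Mazur's version) every \<^class>\<open>real_normed_field\<close> is isometrically isomorphic to one of the two,
  and the equation \<open>x * kcnj x = |x|\<^sup>2\<close> leaves complex conjugation (the identity for the
  reals) as the only choice for \<open>kcnj\<close>.
\<close>

class real_or_complex = real_normed_field +
  fixes kcnj :: "'a \<Rightarrow> 'a"
  assumes kcnj_add: "kcnj (x + y) = kcnj x + kcnj y"
    and mult_kcnj_scaleR: "x * kcnj x = (norm x)\<^sup>2 *\<^sub>R 1"

lemma mult_kcnj: "x * kcnj x = of_real ((norm x)\<^sup>2)"
  for x :: "'a::real_or_complex"
  by (simp add: mult_kcnj_scaleR of_real_def)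

instantiation real :: real_or_complex
begin

definition kcnj_real :: "real \<Rightarrow> real" where
  "kcnj_real x = x"

instance
  by standard (auto simp: kcnj_real_def power2_eq_square)

end

instantiation complex :: real_or_complex
begin

definition kcnj_complex :: "complex \<Rightarrow> complex" where
  "kcnj_complex = cnj"

instance
  by standard (auto simp: kcnj_complex_def scaleR_conv_of_real complex_norm_square
      simp del: of_real_power)

end


definition ip_norm :: "('v \<Rightarrow> 'v \<Rightarrow> 'k::real_or_complex) \<Rightarrow> 'v \<Rightarrow> real" where
  "ip_norm ip x = sqrt (norm (ip x x))"

definition ip_dist :: "('v::ab_group_add \<Rightarrow> 'v \<Rightarrow> 'k::real_or_complex) \<Rightarrow> 'v \<Rightarrow> 'v \<Rightarrow> real" where
  "ip_dist ip x y = ip_norm ip (x - y)"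

lemma kcnj_0 [simp]: "kcnj (0::'k::real_or_complex) = 0"
  using kcnj_add[of "0::'k" 0] by simp

text \<open>Each space is the whole type \<^typ>\<open>'v\<close> with explicitly given scalar multiplication and
  inner product. The inner product is linear in its first argument.\<close>

locale pre_hilbert = vector_space scl
  for scl :: "'k::real_or_complex \<Rightarrow> 'v::ab_group_add \<Rightarrow> 'v" (infixr \<open>\<cdot>\<close> 75) +
  fixes ip :: "'v \<Rightarrow> 'v \<Rightarrow> 'k"
  assumes ip_add_left: "ip (x + y) z = ip x z + ip y z"
    and ip_scale_left: "ip (c \<cdot> x) y = c * ip x y"
    and ip_commute: "ip y x = kcnj (ip x y)"
    and ip_self_nonneg: "\<exists>r\<ge>0. ip x x = of_real r"
    and ip_self_eq_0D: "ip x x = 0 \<Longrightarrow> x = 0"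
begin

lemma ip_add_right: "ip x (y + z) = ip x y + ip x z"
  by (metis ip_add_left ip_commute kcnj_add)

lemma ip_zero_left [simp]: "ip 0 y = 0"
  using ip_add_left[of 0 0 y] by simp

lemma ip_zero_right [simp]: "ip x 0 = 0"
  using ip_add_right[of x 0 0] by simp

lemma ip_minus_left [simp]: "ip (- x) y = - ip x y"
  using ip_add_left[of x "- x" y] by (simp add: add_eq_0_iff)

lemma ip_minus_right [simp]: "ip x (- y) = - ip x y"
  using ip_add_right[of x y "- y"] by (simp add: add_eq_0_iff)

lemma ip_diff_left: "ip (x - y) z = ip x z - ip y z"
  using ip_add_left[of x "- y" z] by simp

lemma ip_diff_right: "ip x (y - z) = ip x y - ip x z"
  using ip_add_right[of x y "- z"] by simp

lemma ip_self: "ip x x = of_real ((ip_norm ip x)\<^sup>2)"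
  using ip_self_nonneg[of x] by (auto simp: ip_norm_def)

lemma ip_norm_nonneg [simp]: "0 \<le> ip_norm ip x"
  by (simp add: ip_norm_def)

lemma ip_norm_eq_0_iff [simp]: "ip_norm ip x = 0 \<longleftrightarrow> x = 0"
  using ip_self_eq_0D by (auto simp: ip_norm_def)

lemma norm_ip_commute: "norm (ip y x) = norm (ip x y)"
proof (cases "ip x y = 0")
  case True
  then show ?thesis
    by (simp add: ip_commute[of y x])
next
  case False
  have "norm (ip x y) * norm (ip y x) = norm (ip x y) * norm (ip x y)"
    using arg_cong[OF mult_kcnj[of "ip x y"], of norm]
    by (simp add: ip_commute[of y x] norm_mult power2_eq_square)
  with False show ?thesis by simp
qed

lemma Cauchy_Schwarz: "norm (ip x y) \<le> ip_norm ip x * ip_norm ip y"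
proof (cases "y = 0")
  case False
  define c where "c = ip x y / ip y y"
  have yy: "ip y y \<noteq> 0" using False ip_self_eq_0D by blast
  define z where "z = x - c \<cdot> y"
  have zy: "ip z y = 0"
    using yy by (simp add: z_def c_def ip_diff_left ip_scale_left)
  then have "ip y z = 0"
    using norm_ip_commute[of y z] by simp
  then have "ip z z = ip z x"
    using norm_ip_commute[of "c \<cdot> y" z] by (simp add: z_def ip_diff_right ip_scale_left)
  also have "\<dots> = ip x x - c * ip y x"
    by (simp add: z_def ip_diff_left ip_scale_left)
  also have "c * ip y x = (ip x y * kcnj (ip x y)) / ip y y"
    by (simp add: c_def ip_commute[of y x])
  also have "\<dots> = of_real ((norm (ip x y))\<^sup>2 / (ip_norm ip y)\<^sup>2)"
    by (simp only: mult_kcnj ip_self of_real_divide)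
  finally have "of_real ((ip_norm ip z)\<^sup>2) =
      (of_real ((ip_norm ip x)\<^sup>2 - (norm (ip x y))\<^sup>2 / (ip_norm ip y)\<^sup>2) :: 'k)"
    by (simp only: ip_self of_real_diff)
  then have "(ip_norm ip z)\<^sup>2 = (ip_norm ip x)\<^sup>2 - (norm (ip x y))\<^sup>2 / (ip_norm ip y)\<^sup>2"
    by (simp only: of_real_eq_iff)
  then have "(norm (ip x y))\<^sup>2 / (ip_norm ip y)\<^sup>2 \<le> (ip_norm ip x)\<^sup>2"
    by (metis diff_ge_0_iff_ge zero_le_power2)
  then have "(norm (ip x y))\<^sup>2 \<le> (ip_norm ip x * ip_norm ip y)\<^sup>2"
    using False by (simp add: divide_le_eq power_mult_distrib split: if_splits)
  then show ?thesis
    by (rule power2_le_imp_le) simp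
qed (simp add: ip_norm_def)

lemma ip_norm_triangle: "ip_norm ip (x + y) \<le> ip_norm ip x + ip_norm ip y"
proof (rule power2_le_imp_le)
  have "(ip_norm ip (x + y))\<^sup>2 = norm (ip (x + y) (x + y))"
    by (simp add: ip_norm_def)
  also have "\<dots> = norm ((ip x x + ip y y) + (ip x y + ip y x))"
    by (simp add: ip_add_left ip_add_right algebra_simps)
  also have "\<dots> \<le> norm (ip x x) + norm (ip y y) + (norm (ip x y) + norm (ip y x))"
    by (intro order.trans[OF norm_triangle_ineq] add_mono norm_triangle_ineq)
  also have "\<dots> \<le> (ip_norm ip x)\<^sup>2 + (ip_norm ip y)\<^sup>2 + 2 * (ip_norm ip x * ip_norm ip y)"
    using Cauchy_Schwarz[of x y] norm_ip_commute[of x y] by (simp add: ip_norm_def)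
  also have "\<dots> = (ip_norm ip x + ip_norm ip y)\<^sup>2"
    by (simp add: power2_sum)
  finally show "(ip_norm ip (x + y))\<^sup>2 \<le> (ip_norm ip x + ip_norm ip y)\<^sup>2" .
qed (simp add: add_nonneg_nonneg)

sublocale Metric_space UNIV "ip_dist ip"
proof
  fix x y z :: 'v
  show "0 \<le> ip_dist ip x y" by (simp add: ip_dist_def)
  have "ip_norm ip (x - y) = ip_norm ip (- (x - y))"
    by (simp only: ip_norm_def ip_minus_left ip_minus_right minus_minus)
  then show "ip_dist ip x y = ip_dist ip y x" by (simp add: ip_dist_def)
  show "ip_dist ip x y = 0 \<longleftrightarrow> x = y" by (simp add: ip_dist_def)
  show "ip_dist ip x z \<le> ip_dist ip x y + ip_dist ip y z"
    using ip_norm_triangle[of "x - y" "y - z"] by (simp add: ip_dist_def)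
qed

end

locale hilbert = pre_hilbert +
  assumes complete: "mcomplete"


definition linear_on ::
  "('k::field \<Rightarrow> 'v::ab_group_add \<Rightarrow> 'v) \<Rightarrow> ('k \<Rightarrow> 'w::ab_group_add \<Rightarrow> 'w)
    \<Rightarrow> 'v set \<Rightarrow> ('v \<Rightarrow> 'w) \<Rightarrow> bool" where
  "linear_on scl1 scl2 D f \<longleftrightarrow>
     (\<forall>x\<in>D. \<forall>y\<in>D. f (x + y) = f x + f y) \<and>
     (\<forall>c. \<forall>x\<in>D. f (scl1 c x) = scl2 c (f x))"

text \<open>An operator is given by its domain \<open>D\<close> and a function \<open>T\<close> whose values outside \<open>D\<close> are
  irrelevant.\<close>

definition linear_operator ::
  "('k::field \<Rightarrow> 'v::ab_group_add \<Rightarrow> 'v) \<Rightarrow> 'v set \<Rightarrow> ('v \<Rightarrow> 'v) \<Rightarrow> bool" where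
  "linear_operator scl D T \<longleftrightarrow> module.subspace scl D \<and> linear_on scl scl D T"

definition densely_defined ::
  "('v::ab_group_add \<Rightarrow> 'v \<Rightarrow> 'k::real_or_complex) \<Rightarrow> 'v set \<Rightarrow> bool" where
  "densely_defined ip D \<longleftrightarrow> Metric_space.mtopology UNIV (ip_dist ip) closure_of D = UNIV"

definition skew_symmetric ::
  "('v \<Rightarrow> 'v \<Rightarrow> 'k::real_or_complex) \<Rightarrow> 'v set \<Rightarrow> ('v \<Rightarrow> 'v) \<Rightarrow> bool" where
  "skew_symmetric ip D T \<longleftrightarrow> (\<forall>u\<in>D. \<forall>v\<in>D. ip (T u) v + ip u (T v) = 0)"

definition adjoint_dom ::
  "('v \<Rightarrow> 'v \<Rightarrow> 'k::real_or_complex) \<Rightarrow> 'v set \<Rightarrow> ('v \<Rightarrow> 'v) \<Rightarrow> 'v set" where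
  "adjoint_dom ip D T = {v. \<exists>w. \<forall>u\<in>D. ip (T u) v = ip u w}"

text \<open>For \<open>v\<close> in \<open>adjoint_dom ip D T\<close> the element \<open>w\<close> is unique if \<open>D\<close> is dense.\<close>

definition adjoint_op ::
  "('v \<Rightarrow> 'v \<Rightarrow> 'k::real_or_complex) \<Rightarrow> 'v set \<Rightarrow> ('v \<Rightarrow> 'v) \<Rightarrow> 'v \<Rightarrow> 'v" where
  "adjoint_op ip D T v = (THE w. \<forall>u\<in>D. ip (T u) v = ip u w)"

definition boundary_quadruple ::
  "('k::real_or_complex \<Rightarrow> 'v::ab_group_add \<Rightarrow> 'v) \<Rightarrow> ('v \<Rightarrow> 'v \<Rightarrow> 'k) \<Rightarrow> 'v set \<Rightarrow> ('v \<Rightarrow> 'v)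
    \<Rightarrow> ('k \<Rightarrow> 'm::ab_group_add \<Rightarrow> 'm) \<Rightarrow> ('m \<Rightarrow> 'm \<Rightarrow> 'k)
    \<Rightarrow> ('k \<Rightarrow> 'p::ab_group_add \<Rightarrow> 'p) \<Rightarrow> ('p \<Rightarrow> 'p \<Rightarrow> 'k)
    \<Rightarrow> ('v \<Rightarrow> 'm) \<Rightarrow> ('v \<Rightarrow> 'p) \<Rightarrow> bool" where
  "boundary_quadruple scl ip D0 A0 scl_minus ip_minus scl_plus ip_plus G_minus G_plus \<longleftrightarrow>
     (let D = adjoint_dom ip D0 A0; A = (\<lambda>u. - adjoint_op ip D0 A0 u) in
        pre_hilbert scl_minus ip_minus \<and> pre_hilbert scl_plus ip_plus \<and>
        linear_on scl scl_minus D G_minus \<and> G_minus ` D = UNIV \<and>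
        linear_on scl scl_plus D G_plus \<and> G_plus ` D = UNIV \<and>
        (\<forall>u\<in>D. \<forall>v\<in>D. ip (A u) v + ip u (A v) =
            ip_plus (G_plus u) (G_plus v) - ip_minus (G_minus u) (G_minus v)) \<and>
        {x + y | x y. x \<in> D \<and> G_minus x = 0 \<and> y \<in> D \<and> G_plus y = 0} = D)"

end

theory Submission
  imports Defs
begin

text \<open>
  Every \<open>w \<in> H\<^sub>+\<close> is \<open>G\<^sub>+ y\<close> for some \<open>y \<in> ker G\<^sub>-\<close> with \<open>A\<^sup>2 y = y\<close>. For \<open>A\<^sup>2 n = n\<close> and such \<open>y\<close> the
  boundary identity turns the graph inner product into \<open>\<langle>n, y\<rangle>\<^sub>A = \<langle>G\<^sub>+ (A n), G\<^sub>+ y\<rangle>\<close>. Hence the lifts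
  of the unit ball of \<open>H\<^sub>+\<close> are weakly bounded in the graph norm, so they are bounded by the uniform
  boundedness principle. Thus a Cauchy sequence in \<open>H\<^sub>+\<close> lifts to one in the graph norm, which
  converges to some \<open>l\<close> in \<open>ker G\<^sub>-\<close>, and \<open>\<parallel>G\<^sub>+ d\<parallel>\<^sup>2 = 2 Re \<langle>A d, d\<rangle> \<le> \<parallel>d\<parallel>\<^sub>A\<^sup>2\<close> for \<open>d \<in> ker G\<^sub>-\<close>
  carries the convergence back to \<open>H\<^sub>+\<close>. Replacing \<open>A\<close> by \<open>- A\<close> interchanges the two boundary
  spaces.
\<close>

section \<open>Pre-Hilbert space geometry and closed orthogonal complements\<close>

context pre_hilbert
begin

lemma ip_eq_0_commute: "ip x y = 0 \<longleftrightarrow> ip y x = 0"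
  using norm_ip_commute[of x y] by (metis norm_eq_zero)

lemma ip_norm_minus_commute: "ip_norm ip (x - y) = ip_norm ip (y - x)"
  using commute[of x y] by (simp add: ip_dist_def)

lemma limitin_sequentially_iff:
  "limitin mtopology f l sequentially \<longleftrightarrow> (\<lambda>n. ip_norm ip (f n - l)) \<longlonglongrightarrow> 0"
  by (simp add: limitin_metric_dist_null ip_dist_def)

lemma MCauchy_iff:
  "MCauchy f \<longleftrightarrow> (\<forall>e>0. \<exists>N. \<forall>m\<ge>N. \<forall>n\<ge>N. ip_norm ip (f m - f n) < e)"
  unfolding MCauchy_def ip_dist_def by auto

lemma tendsto_ip_left:
  assumes "(\<lambda>n. ip_norm ip (f n - l)) \<longlonglongrightarrow> 0"
  shows "(\<lambda>n. ip (f n) a) \<longlonglongrightarrow> ip l a"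
proof -
  have "(\<lambda>n. ip_norm ip (f n - l) * ip_norm ip a) \<longlonglongrightarrow> 0"
    using tendsto_mult_left_zero[OF assms] .
  then have "(\<lambda>n. ip (f n) a - ip l a) \<longlonglongrightarrow> 0"
  proof (rule Lim_null_comparison[rotated])
    show "\<forall>\<^sub>F n in sequentially. norm (ip (f n) a - ip l a) \<le> ip_norm ip (f n - l) * ip_norm ip a"
      using Cauchy_Schwarz[of _ a] by (auto simp flip: ip_diff_left)
  qed
  then show ?thesis by (simp add: LIM_zero_iff)
qed

lemma ip_norm_zero [simp]: "ip_norm ip 0 = 0"
  by (simp add: ip_norm_def)

lemma ip_norm_scale: "ip_norm ip (c \<cdot> x) = norm c * ip_norm ip x"
proof -
  \<comment> \<open>Conjugate-linearity in the second argument is bypassed: only norms matter here,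
    and \<open>norm_ip_commute\<close> brings the scalar into the first argument.\<close>
  have "norm (ip (c \<cdot> x) (c \<cdot> x)) = norm c * norm (ip (c \<cdot> x) x)"
    using norm_ip_commute[of x "c \<cdot> x"] by (simp add: ip_scale_left norm_mult)
  also have "\<dots> = (norm c)\<^sup>2 * norm (ip x x)"
    by (simp add: ip_scale_left norm_mult power2_eq_square)
  finally show ?thesis
    by (simp add: ip_norm_def real_sqrt_mult)
qed

lemma parallelogram:
  "(ip_norm ip (x + y))\<^sup>2 + (ip_norm ip (x - y))\<^sup>2 = 2 * (ip_norm ip x)\<^sup>2 + 2 * (ip_norm ip y)\<^sup>2"
proof -
  have "ip (x + y) (x + y) + ip (x - y) (x - y) = 2 * ip x x + 2 * ip y y"
    by (simp add: ip_add_left ip_add_right ip_diff_left ip_diff_right)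
  then have "(of_real ((ip_norm ip (x + y))\<^sup>2 + (ip_norm ip (x - y))\<^sup>2) :: 'k)
      = of_real (2 * (ip_norm ip x)\<^sup>2 + 2 * (ip_norm ip y)\<^sup>2)"
    by (simp add: ip_self)
  then show ?thesis by (simp only: of_real_eq_iff)
qed

lemma ip_norm_sq: "(ip_norm ip x)\<^sup>2 = norm (ip x x)"
  by (simp add: ip_norm_def)

text \<open>With \<open>c = ip z s / ip s s\<close> the vector \<open>u = z - c \<cdot> s\<close> is
  orthogonal to \<open>s\<close>. By Pythagoras, subtracting \<open>c \<cdot> s\<close> would
  shorten \<open>z\<close> unless \<open>c \<cdot> s = 0\<close>.\<close>

lemma ip_eq_0_of_minimal:
  assumes min: "\<And>c. ip_norm ip z \<le> ip_norm ip (z - c \<cdot> s)"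
  shows "ip z s = 0"
proof (cases "s = 0")
  case False
  then have ss: "ip s s \<noteq> 0" using ip_self_eq_0D by blast
  define c where "c = ip z s / ip s s"
  define u where "u = z - c \<cdot> s"
  have us: "ip u s = 0"
    using ss by (simp add: u_def c_def ip_diff_left ip_scale_left)
  then have "ip (c \<cdot> s) u = 0"
    using ip_eq_0_commute[of u s] by (simp add: ip_scale_left)
  moreover from this have "ip u (c \<cdot> s) = 0"
    using ip_eq_0_commute by blast
  moreover have "z = u + c \<cdot> s" by (simp add: u_def)
  ultimately have "ip z z = ip u u + ip (c \<cdot> s) (c \<cdot> s)"
    by (simp add: ip_add_left ip_add_right)
  then have "(of_real ((ip_norm ip z)\<^sup>2) :: 'k)
      = of_real ((ip_norm ip u)\<^sup>2 + (ip_norm ip (c \<cdot> s))\<^sup>2)"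
    by (simp add: ip_self)
  then have "(ip_norm ip z)\<^sup>2 = (ip_norm ip u)\<^sup>2 + (ip_norm ip (c \<cdot> s))\<^sup>2"
    by (simp only: of_real_eq_iff)
  moreover have "(ip_norm ip z)\<^sup>2 \<le> (ip_norm ip u)\<^sup>2"
    using min[of c] by (simp add: u_def power_mono)
  ultimately have "(ip_norm ip (c \<cdot> s))\<^sup>2 \<le> 0" by simp
  then have "c \<cdot> s = 0" by simp
  then show ?thesis using False ss by (auto simp: c_def)
qed simp

lemma subspace_orthogonal: "subspace {x. \<forall>e\<in>E. ip x e = 0}"
  by (auto simp: subspace_def ip_add_left ip_scale_left)

text \<open>Each \<open>ip _ a\<close> is sequentially continuous by Cauchy-Schwarz. The case
  \<open>k = 0\<close> makes orthogonal complements closed; general \<open>k\<close> supplies the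
  closed sets for the Baire argument.\<close>

lemma closedin_ip_norm_le: "closedin mtopology {x. \<forall>a\<in>B. norm (ip x a) \<le> k}"
  unfolding metric_closedin_iff_sequentially_closed limitin_sequentially_iff
proof (intro conjI allI impI; (elim conjE)?)
  fix f l assume f: "range f \<subseteq> {x. \<forall>a\<in>B. norm (ip x a) \<le> k}"
    and l: "(\<lambda>n. ip_norm ip (f n - l)) \<longlonglongrightarrow> 0"
  show "l \<in> {x. \<forall>a\<in>B. norm (ip x a) \<le> k}"
  proof safe
    fix a assume "a \<in> B"
    then have "\<And>n. norm (ip (f n) a) \<le> k" using f by blast
    then show "norm (ip l a) \<le> k"
      using tendsto_norm[OF tendsto_ip_left[OF l, of a]] by (meson LIMSEQ_le_const2)
  qed
qed simp

lemma closedin_orthogonal: "closedin mtopology {x. \<forall>e\<in>E. ip x e = 0}"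
  using closedin_ip_norm_le[of E 0] by simp

end

section \<open>Orthogonal projection and uniform boundedness\<close>

context hilbert
begin

theorem projection:
  assumes S: "subspace S" "closedin mtopology S"
  obtains p where "p \<in> S" "\<And>s. s \<in> S \<Longrightarrow> ip (x - p) s = 0"
proof -
  define d where "d = (INF s\<in>S. ip_norm ip (x - s))"
  have S0: "0 \<in> S" using S(1) by (rule subspace_0)
  have bdd: "bdd_below ((\<lambda>s. ip_norm ip (x - s)) ` S)"
    by (rule bdd_belowI[of _ 0]) auto
  have d_le: "d \<le> ip_norm ip (x - s)" if "s \<in> S" for s
    unfolding d_def using bdd that by (rule cINF_lower)
  have d0: "0 \<le> d" unfolding d_def using S0 by (intro cINF_greatest) auto
  have "\<exists>s\<in>S. ip_norm ip (x - s) < d + 1 / Suc n" for n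
    using cInf_lessD[of "(\<lambda>s. ip_norm ip (x - s)) ` S" "d + 1 / Suc n"] S0
    by (auto simp: d_def)
  then obtain f where fS: "f n \<in> S" and f: "ip_norm ip (x - f n) < d + 1 / Suc n" for n
    by metis
  \<comment> \<open>\<open>g n\<close> bounds the excess of the squared distance from
    \<open>x\<close> to \<open>f n\<close> over the infimum \<open>d\<^sup>2\<close>.\<close>
  define g where "g n = (d + 1 / Suc n)\<^sup>2 - d\<^sup>2" for n
  have gap: "(ip_norm ip (f m - f n))\<^sup>2 \<le> 2 * g m + 2 * g n" for m n
  proof -
    \<comment> \<open>The midpoint \<open>h\<close> of \<open>f m\<close> and \<open>f n\<close>
      lies in \<open>S\<close>, so \<open>x - h\<close> has norm at least \<open>d\<close>. The
      parallelogram law then turns near-minimality of \<open>f m\<close> and \<open>f n\<close> into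
      closeness to each other.\<close>
    define h where "h = (inverse 2 :: 'a) \<cdot> (f m + f n)"
    have "h \<in> S" unfolding h_def using S(1) fS by (intro subspace_scale subspace_add)
    have "(2::'a) \<cdot> h = f m + f n" by (simp add: h_def)
    then have eq: "(x - f m) + (x - f n) = (2::'a) \<cdot> (x - h)"
      using scale_left_distrib[of 1 1 x] by (simp add: scale_right_diff_distrib)
    have "2 * d \<le> ip_norm ip ((x - f m) + (x - f n))"
      unfolding eq ip_norm_scale using d_le[OF \<open>h \<in> S\<close>] by simp
    then have "(2 * d)\<^sup>2 \<le> (ip_norm ip ((x - f m) + (x - f n)))\<^sup>2"
      using d0 by (intro power_mono) auto
    moreover have "(x - f m) - (x - f n) = f n - f m" by simp
    moreover have "(ip_norm ip (x - f k))\<^sup>2 \<le> (d + 1 / Suc k)\<^sup>2" for k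
      using f[of k] by (intro power_mono) auto
    note this[of m] this[of n]
    ultimately show ?thesis
      using parallelogram[of "x - f m" "x - f n"] ip_norm_minus_commute[of "f m" "f n"]
      by (simp add: power_mult_distrib g_def)
  qed
  have lim: "g \<longlonglongrightarrow> 0"
    unfolding g_def
    using tendsto_power[OF tendsto_add[OF tendsto_const[of d] LIMSEQ_inverse_real_of_nat], of 2]
    by (simp add: LIM_zero_iff inverse_eq_divide)
  have "MCauchy f"
    unfolding MCauchy_iff
  proof (intro allI impI)
    fix e :: real assume "e > 0"
    then have "\<forall>\<^sub>F n in sequentially. g n < e\<^sup>2 / 4"
      using order_tendstoD(2)[OF lim, of "e\<^sup>2 / 4"] by simp
    then obtain N where N: "\<And>n. n \<ge> N \<Longrightarrow> g n < e\<^sup>2 / 4"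
      by (auto simp: eventually_sequentially)
    have "ip_norm ip (f m - f n) < e" if "m \<ge> N" "n \<ge> N" for m n
    proof (rule power2_less_imp_less)
      show "(ip_norm ip (f m - f n))\<^sup>2 < e\<^sup>2"
        using gap[of m n] N[OF that(1)] N[OF that(2)] by linarith
    qed (use \<open>e > 0\<close> in simp)
    then show "\<exists>N. \<forall>m\<ge>N. \<forall>n\<ge>N. ip_norm ip (f m - f n) < e" by blast
  qed
  then obtain p where p: "limitin mtopology f p sequentially"
    using complete by (auto simp: mcomplete_def)
  have pS: "p \<in> S"
    using S(2) p fS unfolding metric_closedin_iff_sequentially_closed by blast
  have "ip_norm ip (x - p) \<le> d"
  proof (rule LIMSEQ_le_const)
    have "(\<lambda>n. (d + 1 / Suc n) + ip_norm ip (f n - p)) \<longlonglongrightarrow> (d + 0) + 0"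
      using p LIMSEQ_inverse_real_of_nat unfolding limitin_sequentially_iff inverse_eq_divide
      by (intro tendsto_intros)
    then show "(\<lambda>n. (d + 1 / Suc n) + ip_norm ip (f n - p)) \<longlonglongrightarrow> d" by simp
    have "ip_norm ip (x - p) \<le> (d + 1 / Suc n) + ip_norm ip (f n - p)" for n
      using ip_norm_triangle[of "x - f n" "f n - p"] f[of n] by simp
    then show "\<exists>N. \<forall>n\<ge>N. ip_norm ip (x - p) \<le> (d + 1 / Suc n) + ip_norm ip (f n - p)"
      by blast
  qed
  then have "ip_norm ip (x - p) \<le> ip_norm ip (x - p - c \<cdot> s)" if "s \<in> S" for c s
    using d_le[OF subspace_add[OF S(1) pS subspace_scale[OF S(1) that]], of c]
    by (simp add: diff_diff_eq)
  then have "ip (x - p) s = 0" if "s \<in> S" for s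
    using that by (intro ip_eq_0_of_minimal)
  with pS show thesis using that by blast
qed

text \<open>Uniform boundedness for the functionals \<open>ip _ a\<close>: the sets
  \<open>F k\<close> are closed and cover the complete space, so by Baire one of them contains a
  ball.\<close>

theorem weakly_bounded_imp_bounded:
  assumes "\<And>x. \<exists>M. \<forall>a\<in>B. norm (ip x a) \<le> M"
  obtains C where "0 \<le> C" "\<And>a. a \<in> B \<Longrightarrow> ip_norm ip a \<le> C"
proof -
  define F where "F k = {x. \<forall>a\<in>B. norm (ip x a) \<le> real k}" for k
  have "\<exists>k. x \<in> F k" for x
  proof -
    obtain M where "\<forall>a\<in>B. norm (ip x a) \<le> M" using assms by blast
    moreover obtain k where "M \<le> real k" using real_arch_simple by blast
    ultimately show ?thesis unfolding F_def using order_trans by blast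
  qed
  then have "\<Union>(range F) = UNIV" by blast
  then have "mtopology interior_of (\<Union>(range F)) = UNIV"
    using interior_of_topspace[of mtopology] by simp
  moreover have "closedin mtopology (F k)" for k
    unfolding F_def by (rule closedin_ip_norm_le)
  ultimately have "\<not> (\<forall>k. mtopology interior_of F k = {})"
    using metric_Baire_category_alt[OF complete, of "range F"] by auto
  then obtain k x r where r: "r > 0" and sub: "mball x r \<subseteq> F k"
    by (auto simp: metric_interior_of)
  have "ip_norm ip a \<le> 4 * real k / r" if "a \<in> B" for a
  proof (cases "a = 0")
    case False
    define n where "n = ip_norm ip a"
    have n: "n > 0" using False ip_norm_nonneg[of a] by (simp add: n_def less_le)
    \<comment> \<open>\<open>h\<close> is \<open>a\<close> rescaled to norm \<open>r / 2\<close>, so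
      \<open>x\<close> and \<open>x - h\<close> both lie in the ball. The difference of their
      pairings with \<open>a\<close> is at most \<open>2 * k\<close>, while \<open>ip h a\<close>
      has norm \<open>r / 2\<close> times that of \<open>a\<close>.\<close>
    define h where "h = (of_real (r / (2 * n)) :: 'a) \<cdot> a"
    have "ip_norm ip h = r / 2" using n r unfolding h_def ip_norm_scale norm_of_real n_def[symmetric] by simp
    then have "x \<in> mball x r" "x - h \<in> mball x r" using r by (auto simp: ip_dist_def)
    then have "norm (ip x a) \<le> k" "norm (ip (x - h) a) \<le> k"
      using sub \<open>a \<in> B\<close> by (auto simp: F_def)
    then have "norm (ip h a) \<le> 2 * real k"
      using norm_triangle_ineq4[of "ip x a" "ip (x - h) a"] by (simp add: ip_diff_left)
    moreover have "norm (ip h a) = r / (2 * n) * n\<^sup>2"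
      using n r unfolding h_def ip_scale_left norm_mult ip_self norm_of_real n_def[symmetric] by simp
    ultimately show ?thesis using n r by (simp add: n_def[symmetric] field_simps power2_eq_square)
  qed (use r in simp)
  then show thesis using that[of "4 * real k / r"] r by auto
qed

end

section \<open>The Hilbert space of pairs\<close>

definition prod_scale :: "('k \<Rightarrow> 'v \<Rightarrow> 'v) \<Rightarrow> 'k \<Rightarrow> 'v \<times> 'v \<Rightarrow> 'v \<times> 'v" where
  "prod_scale scl c x = (scl c (fst x), scl c (snd x))"

text \<open>On pairs \<open>(u, A u)\<close> this is the graph inner product of \<open>A\<close>, so
  graph-norm arguments become arguments in the product space.\<close>

definition prod_ip :: "('v \<Rightarrow> 'v \<Rightarrow> 'k::plus) \<Rightarrow> 'v \<times> 'v \<Rightarrow> 'v \<times> 'v \<Rightarrow> 'k" where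
  "prod_ip ip x y = ip (fst x) (fst y) + ip (snd x) (snd y)"

lemma prod_scale_Pair [simp]: "prod_scale scl c (a, b) = (scl c a, scl c b)"
  by (simp add: prod_scale_def)

lemma prod_ip_Pair [simp]: "prod_ip ip (a, b) (c, d) = ip a c + ip b d"
  by (simp add: prod_ip_def)

context pre_hilbert
begin

lemma prod_ip_self: "prod_ip ip x x = of_real ((ip_norm ip (fst x))\<^sup>2 + (ip_norm ip (snd x))\<^sup>2)"
  by (simp add: prod_ip_def ip_self)

lemma ip_norm_prod_sq:
  "(ip_norm (prod_ip ip) x)\<^sup>2 = (ip_norm ip (fst x))\<^sup>2 + (ip_norm ip (snd x))\<^sup>2"
  unfolding ip_norm_def[of "prod_ip ip"] prod_ip_self norm_of_real by simp

lemma ip_norm_prod_nonneg: "0 \<le> ip_norm (prod_ip ip) x"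
  by (simp add: ip_norm_def)

lemma ip_norm_fst_le: "ip_norm ip (fst x) \<le> ip_norm (prod_ip ip) x"
  by (rule power2_le_imp_le[OF _ ip_norm_prod_nonneg]) (simp add: ip_norm_prod_sq)

lemma ip_norm_snd_le: "ip_norm ip (snd x) \<le> ip_norm (prod_ip ip) x"
  by (rule power2_le_imp_le[OF _ ip_norm_prod_nonneg]) (simp add: ip_norm_prod_sq)

lemma ip_norm_prod_le:
  "ip_norm (prod_ip ip) x \<le> ip_norm ip (fst x) + ip_norm ip (snd x)"
  by (rule power2_le_imp_le) (simp_all add: ip_norm_prod_sq power2_sum)

lemma pre_hilbert_prod: "pre_hilbert (prod_scale scl) (prod_ip ip)"
proof unfold_locales
  fix x y z :: "'v \<times> 'v" and a b :: 'k
  show "prod_scale scl a (x + y) = prod_scale scl a x + prod_scale scl a y"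
    "prod_scale scl (a + b) x = prod_scale scl a x + prod_scale scl b x"
    "prod_scale scl a (prod_scale scl b x) = prod_scale scl (a * b) x"
    "prod_scale scl 1 x = x"
    by (simp_all add: prod_scale_def scale_right_distrib scale_left_distrib plus_prod_def)
  show "prod_ip ip (x + y) z = prod_ip ip x z + prod_ip ip y z"
    by (simp add: prod_ip_def ip_add_left)
  show "prod_ip ip (prod_scale scl a x) y = a * prod_ip ip x y"
    by (simp add: prod_ip_def prod_scale_def ip_scale_left distrib_left)
  show "prod_ip ip y x = kcnj (prod_ip ip x y)"
    by (simp add: prod_ip_def kcnj_add flip: ip_commute)
  show "\<exists>r\<ge>0. prod_ip ip x x = of_real r"
    unfolding prod_ip_self by (intro exI conjI; (rule refl)?) simp
  show "prod_ip ip x x = 0 \<Longrightarrow> x = 0"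
    unfolding prod_ip_self of_real_eq_0_iff by (simp add: add_nonneg_eq_0_iff prod_eq_iff)
qed

end

context hilbert
begin

lemma hilbert_prod: "hilbert (prod_scale scl) (prod_ip ip)"
proof -
  interpret H: pre_hilbert "prod_scale scl" "prod_ip ip" by (rule pre_hilbert_prod)
  show ?thesis
  proof
    show "H.mcomplete"
      unfolding H.mcomplete_def
    proof (intro allI impI)
      fix f assume f: "H.MCauchy f"
      have "MCauchy (\<lambda>n. fst (f n))" "MCauchy (\<lambda>n. snd (f n))"
        using f ip_norm_fst_le[of "f m - f n" for m n] ip_norm_snd_le[of "f m - f n" for m n]
        unfolding MCauchy_iff H.MCauchy_iff by (simp_all, meson le_less_trans)+
      then obtain a b where "limitin mtopology (\<lambda>n. fst (f n)) a sequentially"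
        "limitin mtopology (\<lambda>n. snd (f n)) b sequentially"
        using complete unfolding mcomplete_def by blast
      then have "(\<lambda>n. ip_norm ip (fst (f n) - a) + ip_norm ip (snd (f n) - b)) \<longlonglongrightarrow> 0"
        unfolding limitin_sequentially_iff using tendsto_add by fastforce
      then have "(\<lambda>n. ip_norm (prod_ip ip) (f n - (a, b))) \<longlonglongrightarrow> 0"
      proof (rule Lim_null_comparison[rotated])
        have "ip_norm (prod_ip ip) (f n - (a, b)) \<le> ip_norm ip (fst (f n) - a) + ip_norm ip (snd (f n) - b)"
          for n using ip_norm_prod_le[of "f n - (a, b)"] by simp
        then show "\<forall>\<^sub>F n in sequentially. norm (ip_norm (prod_ip ip) (f n - (a, b)))
            \<le> ip_norm ip (fst (f n) - a) + ip_norm ip (snd (f n) - b)"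
          by (simp add: ip_norm_prod_nonneg)
      qed
      then show "\<exists>x. limitin H.mtopology f x sequentially"
        unfolding H.limitin_sequentially_iff by blast
    qed
  qed
qed

end

section \<open>The graph of \<open>A\<close> and its boundary maps\<close>

text \<open>Since \<open>A\<close> agrees with \<open>A\<^sub>0\<close> on \<open>D\<^sub>0\<close>, the equation \<open>A = - A\<^sub>0\<^sup>*\<close> says that the graph of \<open>A\<close> is
  the orthogonal complement of \<open>{(A m, m) | m \<in> D\<^sub>0}\<close>. In this form the setting is invariant under
  replacing \<open>A\<close> by \<open>- A\<close> and swapping the two boundary maps.\<close>

locale skew_boundary = hilbert scl ip + M: pre_hilbert scl_minus ip_minus + P: pre_hilbert scl_plus ip_plus
  for scl :: "'k::real_or_complex \<Rightarrow> 'v::ab_group_add \<Rightarrow> 'v" and ip :: "'v \<Rightarrow> 'v \<Rightarrow> 'k"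
    and scl_minus :: "'k \<Rightarrow> 'm::ab_group_add \<Rightarrow> 'm" and ip_minus :: "'m \<Rightarrow> 'm \<Rightarrow> 'k"
    and scl_plus :: "'k \<Rightarrow> 'p::ab_group_add \<Rightarrow> 'p" and ip_plus :: "'p \<Rightarrow> 'p \<Rightarrow> 'k" +
  fixes D0 D :: "'v set" and A :: "'v \<Rightarrow> 'v" and G_minus :: "'v \<Rightarrow> 'm" and G_plus :: "'v \<Rightarrow> 'p"
  assumes D0_subset: "D0 \<subseteq> D"
    and graph_iff: "v \<in> D \<and> A v = w \<longleftrightarrow> (\<forall>m\<in>D0. ip (A m) v + ip m w = 0)"
    and linear_minus: "linear_on scl scl_minus D G_minus"
    and linear_plus: "linear_on scl scl_plus D G_plus"
    and surj_minus: "G_minus ` D = UNIV"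
    and surj_plus: "G_plus ` D = UNIV"
    and green: "u \<in> D \<Longrightarrow> v \<in> D \<Longrightarrow> ip (A u) v + ip u (A v) =
      ip_plus (G_plus u) (G_plus v) - ip_minus (G_minus u) (G_minus v)"
    and kernels: "{x + y | x y. x \<in> D \<and> G_minus x = 0 \<and> y \<in> D \<and> G_plus y = 0} = D"
begin

sublocale H: hilbert "prod_scale scl" "prod_ip ip"
  by (rule hilbert_prod)

text \<open>Orthogonality is turned around so that the graph element stands in the first slot, the
  form in which orthogonal complements are known to be closed subspaces.\<close>

lemma graph_orthogonal_iff:
  "v \<in> D \<and> A v = w \<longleftrightarrow> (\<forall>m\<in>D0. prod_ip ip (v, w) (A m, m) = 0)"
  unfolding graph_iff by (subst H.ip_eq_0_commute) simp

text \<open>Linearity of \<open>A\<close> comes from \<open>graph_iff\<close>, whose right-hand side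
  is additive in the pair \<open>(v, w)\<close>.\<close>

lemma D_diff: "x \<in> D \<Longrightarrow> y \<in> D \<Longrightarrow> x - y \<in> D \<and> A (x - y) = A x - A y"
  using graph_iff[of x "A x"] graph_iff[of y "A y"] graph_iff[of "x - y" "A x - A y"]
  by (simp add: ip_diff_right) (metis add_diff_add diff_zero)

lemma D_scale: "x \<in> D \<Longrightarrow> scl c x \<in> D \<and> A (scl c x) = scl c (A x)"
  using graph_orthogonal_iff[of x "A x"] graph_orthogonal_iff[of "scl c x" "scl c (A x)"]
    H.ip_scale_left[of c "(x, A x)"] by (simp del: prod_ip_Pair)

lemma G_diff:
  assumes "x \<in> D" "y \<in> D"
  shows "G_minus (x - y) = G_minus x - G_minus y" "G_plus (x - y) = G_plus x - G_plus y"
proof -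
  have "x - y \<in> D" using D_diff assms by blast
  then show "G_minus (x - y) = G_minus x - G_minus y" "G_plus (x - y) = G_plus x - G_plus y"
    using linear_minus linear_plus assms(2) unfolding linear_on_def
    by (metis diff_add_cancel eq_diff_eq)+
qed

text \<open>Dropping the summand in the kernel of \<open>G_plus\<close> does not change
  \<open>G_plus\<close>. Such vectors serve as test vectors: in \<open>green\<close> they leave only
  the \<open>ip_plus\<close> term.\<close>

lemma exists_ker_minus:
  obtains v where "v \<in> D" "G_minus v = 0" "G_plus v = w"
proof -
  obtain v where v: "v \<in> D" "G_plus v = w" using surj_plus by (metis UNIV_I imageE)
  then obtain x y where "v = x + y" "x \<in> D" "G_minus x = 0" "y \<in> D" "G_plus y = 0"
    using kernels by blast
  then show thesis
    using that v linear_plus unfolding linear_on_def by (metis add.right_neutral)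
qed

lemma exists_ker_plus:
  obtains v where "v \<in> D" "G_plus v = 0" "G_minus v = w"
proof -
  obtain v where v: "v \<in> D" "G_minus v = w" using surj_minus by (metis UNIV_I imageE)
  then obtain x y where "v = x + y" "x \<in> D" "G_minus x = 0" "y \<in> D" "G_plus y = 0"
    using kernels by blast
  then show thesis
    using that v linear_minus unfolding linear_on_def by (metis add.left_neutral)
qed

section \<open>The graph-orthogonal complement of \<open>D0\<close> and bounded lifts\<close>

text \<open>This is the complement of \<open>D0\<close> in the graph inner product on
  \<open>D\<close>: \<open>ip (A m) (A y) + ip m y = 0\<close> for all \<open>m \<in> D0\<close>
  says, by \<open>graph_iff\<close>, that \<open>A y \<in> D\<close> and
  \<open>A (A y) = y\<close>.\<close>

definition N :: "'v set" where
  "N = {y \<in> D. A y \<in> D \<and> A (A y) = y}"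

text \<open>Orthogonality of \<open>(y, z)\<close> to the first family means \<open>A y = z\<close>,
  to the second \<open>A z = y\<close>. Hence the graph of \<open>A\<close> over \<open>N\<close> is
  an orthogonal complement and therefore closed.\<close>

definition N_normals :: "('v \<times> 'v) set" where
  "N_normals = (\<lambda>m. (A m, m)) ` D0 \<union> (\<lambda>m. (m, A m)) ` D0"

lemma N_graph_iff: "y \<in> N \<and> A y = z \<longleftrightarrow> (\<forall>e\<in>N_normals. prod_ip ip (y, z) e = 0)"
proof -
  have "y \<in> N \<and> A y = z \<longleftrightarrow> (y \<in> D \<and> A y = z) \<and> (z \<in> D \<and> A z = y)"
    by (auto simp: N_def)
  then show ?thesis
    unfolding graph_orthogonal_iff N_normals_def ball_Un by (simp add: add.commute)
qed

lemma N_diff: "x \<in> N \<Longrightarrow> y \<in> N \<Longrightarrow> x - y \<in> N"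
  unfolding N_def using D_diff by (metis (mono_tags, lifting) mem_Collect_eq)

text \<open>Apply \<open>green\<close> to \<open>A x\<close> and \<open>y\<close>: since
  \<open>A (A x) = x\<close>, its left side is the graph inner product, and the minus term
  vanishes.\<close>

lemma prod_ip_N:
  assumes "x \<in> N" "y \<in> N" "G_minus y = 0"
  shows "prod_ip ip (x, A x) (y, A y) = ip_plus (G_plus (A x)) (G_plus y)"
  using green[of "A x" y] assms by (simp add: N_def)

text \<open>The element \<open>y\<close> is obtained from any \<open>v\<close> with the same boundary values by removing the
  component in the domain of the closure of \<open>A\<^sub>0\<close>, whose boundary values vanish.\<close>

lemma exists_lift:
  obtains y where "y \<in> N" "G_minus y = 0" "G_plus y = w"
proof -
  obtain v where v: "v \<in> D" "G_minus v = 0" "G_plus v = w" by (rule exists_ker_minus)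
  \<comment> \<open>By \<open>graph_orthogonal_iff\<close>, \<open>S\<close> is the double
    orthogonal complement of the pairs \<open>(m, A m)\<close> with \<open>m \<in> D0\<close>. It
    contains these pairs and is itself contained in the graph of \<open>A\<close>.\<close>
  define S where "S = {s. \<forall>e\<in>(\<lambda>u. (A u, u)) ` D. prod_ip ip s e = 0}"
  obtain p where pS: "p \<in> S" and orth: "\<And>s. s \<in> S \<Longrightarrow> prod_ip ip ((v, A v) - p) s = 0"
    using H.projection[of S "(v, A v)"] H.subspace_orthogonal H.closedin_orthogonal
    unfolding S_def by blast
  obtain q r where p: "p = (q, r)" by fastforce
  have q: "q \<in> D" "A q = r"
    using pS D0_subset graph_orthogonal_iff[of q r] by (auto simp: S_def p)
  have G: "ip_plus (G_plus q) (G_plus u) - ip_minus (G_minus q) (G_minus u) = 0" if "u \<in> D" for u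
    using green[OF q(1) that] pS that q(2) by (simp add: S_def p add.commute)
  \<comment> \<open>\<open>G\<close> says that the boundary form of \<open>q\<close> vanishes
    against all of \<open>D\<close>. Choosing \<open>u\<close> with \<open>G_minus u = 0\<close> and
    the same \<open>G_plus\<close> value as \<open>q\<close> leaves the square norm of
    \<open>G_plus q\<close>.\<close>
  obtain u where "u \<in> D" "G_minus u = 0" "G_plus u = G_plus q" by (rule exists_ker_minus)
  then have "G_plus q = 0" using G[of u] P.ip_self_eq_0D by simp
  moreover
  obtain u where "u \<in> D" "G_plus u = 0" "G_minus u = G_minus q" by (rule exists_ker_plus)
  then have "G_minus q = 0" using G[of u] M.ip_self_eq_0D by simp
  moreover have "v - q \<in> N"
  proof -
    \<comment> \<open>Orthogonality of \<open>(v, A v) - p\<close> to \<open>(m, A m)\<close>, read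
      with components swapped, is the graph condition for \<open>A (v - q)\<close> with value
      \<open>v - q\<close>.\<close>
    have "prod_ip ip (A (v - q), v - q) (A m, m) = 0" if "m \<in> D0" for m
    proof -
      have "prod_ip ip (m, A m) (A u, u) = 0" if "u \<in> D" for u
        using graph_iff[of u "A u"] that \<open>m \<in> D0\<close> by (simp add: add.commute)
      then have "(m, A m) \<in> S" by (auto simp: S_def)
      from orth[OF this] show ?thesis
        using D_diff[OF v(1) q(1)] q(2) by (simp add: p add.commute)
    qed
    then have "A (v - q) \<in> D \<and> A (A (v - q)) = v - q"
      unfolding graph_orthogonal_iff by blast
    then show ?thesis using D_diff[OF v(1) q(1)] by (simp add: N_def)
  qed
  ultimately show thesis
    using that[of "v - q"] G_diff[OF v(1) q(1)] v by simp
qed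

lemma lift_bounded:
  obtains C where "0 \<le> C"
    "\<And>y. y \<in> N \<Longrightarrow> G_minus y = 0 \<Longrightarrow> ip_norm (prod_ip ip) (y, A y) \<le> C * ip_norm ip_plus (G_plus y)"
proof -
  define B where "B = {(y, A y) | y. y \<in> N \<and> G_minus y = 0 \<and> ip_norm ip_plus (G_plus y) \<le> 1}"
  have "\<exists>M. \<forall>a\<in>B. norm (prod_ip ip x a) \<le> M" for x
  proof -
    \<comment> \<open>\<open>S\<close> is the graph of \<open>A\<close> over \<open>N\<close>, which
      contains \<open>B\<close>. Pairing with \<open>B\<close> is unchanged when \<open>x\<close> is
      replaced by its projection \<open>n = (z, A z)\<close>, and then \<open>prod_ip_N\<close> with
      Cauchy-Schwarz in the plus space gives a bound independent of \<open>a\<close>.\<close>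
    define S where "S = {s. \<forall>e\<in>N_normals. prod_ip ip s e = 0}"
    obtain n where nS: "n \<in> S" and orth: "\<And>s. s \<in> S \<Longrightarrow> prod_ip ip (x - n) s = 0"
      using H.projection[of S x] H.subspace_orthogonal H.closedin_orthogonal
      unfolding S_def by blast
    obtain z where z: "z \<in> N" "n = (z, A z)"
      using nS N_graph_iff[of "fst n" "snd n"] by (cases n) (auto simp: S_def)
    have "norm (prod_ip ip x a) \<le> ip_norm ip_plus (G_plus (A z))" if "a \<in> B" for a
    proof -
      obtain y where y: "a = (y, A y)" "y \<in> N" "G_minus y = 0" "ip_norm ip_plus (G_plus y) \<le> 1"
        using \<open>a \<in> B\<close> by (auto simp: B_def)
      have "prod_ip ip (x - n) a = 0"
        using orth y(1,2) N_graph_iff[of y "A y"] unfolding S_def by blast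
      then have "prod_ip ip x a = ip_plus (G_plus (A z)) (G_plus y)"
        using prod_ip_N[OF z(1) y(2,3)] by (simp add: H.ip_diff_left y(1) z(2))
      then show ?thesis
        using P.Cauchy_Schwarz[of "G_plus (A z)" "G_plus y"] y(4)
          mult_left_le[OF y(4), of "ip_norm ip_plus (G_plus (A z))"] by simp
    qed
    then show ?thesis by blast
  qed
  then obtain C where C: "0 \<le> C" "\<And>a. a \<in> B \<Longrightarrow> ip_norm (prod_ip ip) a \<le> C"
    using H.weakly_bounded_imp_bounded by metis
  have "ip_norm (prod_ip ip) (y, A y) \<le> C * ip_norm ip_plus (G_plus y)"
    if y: "y \<in> N" "G_minus y = 0" for y
  proof (cases "G_plus y = 0")
    case True
    \<comment> \<open>By \<open>prod_ip_N\<close> the squared graph norm of \<open>y\<close> is a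
      pairing with \<open>G_plus y = 0\<close>.\<close>
    then have "(y, A y) = 0"
      using prod_ip_N[OF y(1) y] H.ip_self_eq_0D by simp
    then show ?thesis using C(1) by simp
  next
    case False
    define r where "r = ip_norm ip_plus (G_plus y)"
    have r: "0 < r" using False P.ip_norm_nonneg[of "G_plus y"] by (simp add: r_def less_le)
    \<comment> \<open>Scaling by \<open>inverse r\<close> makes the boundary norm one, so that the
      bound on \<open>B\<close> applies.\<close>
    define c where "c = (of_real (inverse r) :: 'k)"
    have norm_c: "norm c = inverse r" using r unfolding c_def norm_of_real by simp
    have y': "y \<in> D" "A y \<in> D" "A (A y) = y" using y by (auto simp: N_def)
    have Gc: "G_plus (scl c y) = scl_plus c (G_plus y)" "G_minus (scl c y) = scl_minus c (G_minus y)"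
      using linear_plus linear_minus y'(1) by (auto simp: linear_on_def)
    have "(scl c y, A (scl c y)) \<in> B"
      unfolding B_def using D_scale[OF y'(1), of c] D_scale[OF y'(2), of c] y' y(2) Gc r
      by (auto simp: N_def P.ip_norm_scale norm_c r_def[symmetric])
    then have "ip_norm (prod_ip ip) (prod_scale scl c (y, A y)) \<le> C"
      using C(2) D_scale[OF y'(1), of c] by simp
    then show ?thesis
      using r unfolding H.ip_norm_scale by (simp add: norm_c r_def[symmetric] field_simps)
  qed
  with C(1) show thesis using that by blast
qed

section \<open>Completeness of the plus boundary space\<close>

theorem mcomplete_plus: "P.mcomplete"
  unfolding P.mcomplete_def
proof (intro allI impI)
  fix f assume f: "P.MCauchy f"
  have "\<forall>n. \<exists>y. y \<in> N \<and> G_minus y = 0 \<and> G_plus y = f n" by (metis exists_lift)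
  then obtain y where "\<forall>n. y n \<in> N \<and> G_minus (y n) = 0 \<and> G_plus (y n) = f n"
    by (rule choice[THEN exE])
  then have y: "\<And>n. y n \<in> N" "\<And>n. G_minus (y n) = 0" "\<And>n. G_plus (y n) = f n"
    by blast+
  have yD: "y n \<in> D" for n using y(1) by (simp add: N_def)
  define Y where "Y n = (y n, A (y n))" for n
  obtain C where C: "0 \<le> C" "\<And>y. y \<in> N \<Longrightarrow> G_minus y = 0 \<Longrightarrow>
      ip_norm (prod_ip ip) (y, A y) \<le> C * ip_norm ip_plus (G_plus y)"
    by (rule lift_bounded) blast
  have diff: "ip_norm (prod_ip ip) (Y m - Y n) \<le> C * ip_norm ip_plus (f m - f n)" for m n
    using C(2)[OF N_diff[OF y(1)[of m] y(1)[of n]]] G_diff[OF yD[of m] yD[of n]]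
      D_diff[OF yD[of m] yD[of n]] y by (simp add: Y_def)
  have "H.MCauchy Y"
    unfolding H.MCauchy_iff
  proof (intro allI impI)
    fix e :: real assume "e > 0"
    \<comment> \<open>\<open>C\<close> may be zero, so \<open>C + 1\<close> is used as the
      divisor.\<close>
    then have "e / (C + 1) > 0" using C(1) by simp
    then obtain K where K: "\<And>m n. m \<ge> K \<Longrightarrow> n \<ge> K \<Longrightarrow> ip_norm ip_plus (f m - f n) < e / (C + 1)"
      using f unfolding P.MCauchy_iff by blast
    have "ip_norm (prod_ip ip) (Y m - Y n) < e" if "m \<ge> K" "n \<ge> K" for m n
    proof -
      have "C * ip_norm ip_plus (f m - f n) \<le> C * (e / (C + 1))"
        using K[OF that] C(1) by (intro mult_left_mono) auto
      also have "\<dots> < e" using C(1) \<open>e > 0\<close> by (simp add: field_simps)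
      finally show ?thesis using diff[of m n] by linarith
    qed
    then show "\<exists>K. \<forall>m\<ge>K. \<forall>n\<ge>K. ip_norm (prod_ip ip) (Y m - Y n) < e" by blast
  qed
  then obtain L where L: "limitin H.mtopology Y L sequentially"
    using H.complete unfolding H.mcomplete_def by blast
  have lim: "(\<lambda>n. ip_norm (prod_ip ip) (Y n - L)) \<longlonglongrightarrow> 0"
    using L by (simp add: H.limitin_sequentially_iff)
  have "\<And>n. Y n \<in> {s. \<forall>e\<in>N_normals. prod_ip ip s e = 0}"
    using y(1) N_graph_iff unfolding Y_def by blast
  then have "L \<in> {s. \<forall>e\<in>N_normals. prod_ip ip s e = 0}"
    using H.closedin_orthogonal[of N_normals] L
    unfolding H.metric_closedin_iff_sequentially_closed by blast
  then obtain l where l: "l \<in> N" "L = (l, A l)"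
    using N_graph_iff[of "fst L" "snd L"] by (cases L) auto
  have lD: "l \<in> D" using l by (simp add: N_def)
  \<comment> \<open>The boundary value is tested weakly: for \<open>u\<close> with
    \<open>G_plus u = 0\<close>, \<open>green\<close> expresses the pairing of
    \<open>G_minus\<close> values as an inner product with \<open>(A u, u)\<close>, which does pass
    to the limit. Choosing \<open>G_minus u = G_minus l\<close> finishes.\<close>
  have "G_minus l = 0"
  proof -
    obtain u where u: "u \<in> D" "G_plus u = 0" "G_minus u = G_minus l" by (rule exists_ker_plus)
    have "prod_ip ip (Y n) (A u, u) = 0" for n
      using green[OF yD[of n] u(1)] u(2) y(2) by (simp add: Y_def add.commute)
    then have "prod_ip ip L (A u, u) = 0"
      using H.tendsto_ip_left[OF lim, of "(A u, u)"] by (simp add: LIMSEQ_const_iff)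
    then have "ip_minus (G_minus l) (G_minus l) = 0"
      using green[OF lD u(1)] u(2,3) by (simp add: l(2) add.commute)
    then show ?thesis by (rule M.ip_self_eq_0D)
  qed
  have "ip_norm ip_plus (f n - G_plus l) \<le> ip_norm (prod_ip ip) (Y n - L)" for n
  proof (rule power2_le_imp_le)
    define d where "d = y n - l"
    have d: "d \<in> D" "A d = A (y n) - A l" using D_diff[OF yD lD] by (auto simp: d_def)
    have G: "G_minus d = 0" "G_plus d = f n - G_plus l"
      using G_diff[OF yD lD] y \<open>G_minus l = 0\<close> by (simp_all add: d_def)
    \<comment> \<open>As \<open>G_minus d = 0\<close>, \<open>green\<close> for \<open>d\<close>
      with itself gives the pairing of \<open>(d, A d)\<close> with its swap. Swapping components
      preserves the norm, so Cauchy-Schwarz bounds it by the squared graph norm.\<close>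
    have "(ip_norm ip_plus (f n - G_plus l))\<^sup>2 = norm (prod_ip ip (d, A d) (A d, d))"
      using green[OF d(1) d(1)] by (simp add: P.ip_norm_sq G add.commute)
    also have "\<dots> \<le> ip_norm (prod_ip ip) (d, A d) * ip_norm (prod_ip ip) (A d, d)"
      by (rule H.Cauchy_Schwarz)
    also have "ip_norm (prod_ip ip) (A d, d) = ip_norm (prod_ip ip) (d, A d)"
      by (simp add: ip_norm_def add.commute)
    also have "(d, A d) = Y n - L" by (simp add: Y_def l(2) d) (simp add: d_def)
    finally show "(ip_norm ip_plus (f n - G_plus l))\<^sup>2 \<le> (ip_norm (prod_ip ip) (Y n - L))\<^sup>2"
      by (simp add: power2_eq_square)
  qed simp
  then have "(\<lambda>n. ip_norm ip_plus (f n - G_plus l)) \<longlonglongrightarrow> 0"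
    by (intro Lim_null_comparison[OF _ lim]) simp
  then show "\<exists>x. limitin P.mtopology f x sequentially"
    unfolding P.limitin_sequentially_iff by blast
qed

end

section \<open>The adjoint of a densely defined operator and the two boundary spaces\<close>

lemma (in pre_hilbert) dense_orthogonal_eq_0:
  assumes "densely_defined ip D" and "\<And>u. u \<in> D \<Longrightarrow> ip u w = 0"
  shows "w = 0"
proof -
  have "D \<subseteq> {x. \<forall>e\<in>{w}. ip x e = 0}" using assms(2) by blast
  then have "mtopology closure_of D \<subseteq> {x. \<forall>e\<in>{w}. ip x e = 0}"
    using closedin_orthogonal by (rule closure_of_minimal)
  then have "ip w w = 0" using assms(1) by (auto simp: densely_defined_def)
  then show ?thesis by (rule ip_self_eq_0D)
qed

text \<open>Density makes the witness \<open>w\<close> unique, so the definite description in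
  \<open>adjoint_op\<close> denotes it.\<close>

lemma (in pre_hilbert) adjoint_iff:
  assumes "densely_defined ip D"
  shows "v \<in> adjoint_dom ip D T \<and> adjoint_op ip D T v = w \<longleftrightarrow> (\<forall>u\<in>D. ip (T u) v = ip u w)"
proof -
  have uniq: "w = w'" if "\<forall>u\<in>D. ip (T u) v = ip u w" "\<forall>u\<in>D. ip (T u) v = ip u w'" for w w'
    using dense_orthogonal_eq_0[OF assms, of "w - w'"] that by (simp add: ip_diff_right)
  then have "adjoint_op ip D T v = w" if "\<forall>u\<in>D. ip (T u) v = ip u w" for w
    unfolding adjoint_op_def using that by (intro the_equality) blast+
  then show ?thesis by (auto simp: adjoint_dom_def)
qed

theorem proposition3p5:
  fixes scl :: "'k::real_or_complex \<Rightarrow> 'v::ab_group_add \<Rightarrow> 'v"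
    and ip :: "'v \<Rightarrow> 'v \<Rightarrow> 'k"
    and D0 :: "'v set" and A0 :: "'v \<Rightarrow> 'v"
    and scl_minus :: "'k \<Rightarrow> 'm::ab_group_add \<Rightarrow> 'm" and ip_minus :: "'m \<Rightarrow> 'm \<Rightarrow> 'k"
    and scl_plus :: "'k \<Rightarrow> 'p::ab_group_add \<Rightarrow> 'p" and ip_plus :: "'p \<Rightarrow> 'p \<Rightarrow> 'k"
    and G_minus :: "'v \<Rightarrow> 'm" and G_plus :: "'v \<Rightarrow> 'p"
  assumes "hilbert scl ip"
    and "linear_operator scl D0 A0"
    and "densely_defined ip D0"
    and "skew_symmetric ip D0 A0"
    and "boundary_quadruple scl ip D0 A0
           scl_minus ip_minus scl_plus ip_plus G_minus G_plus"
  shows "Metric_space.mcomplete UNIV (ip_dist ip_minus) \<and>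
         Metric_space.mcomplete UNIV (ip_dist ip_plus)"
proof -
  define D where "D = adjoint_dom ip D0 A0"
  define A where "A u = - adjoint_op ip D0 A0 u" for u
  interpret hilbert scl ip by fact
  have quad: "pre_hilbert scl_minus ip_minus" "pre_hilbert scl_plus ip_plus"
    "linear_on scl scl_minus D G_minus" "G_minus ` D = UNIV"
    "linear_on scl scl_plus D G_plus" "G_plus ` D = UNIV"
    and green: "\<And>u v. u \<in> D \<Longrightarrow> v \<in> D \<Longrightarrow> ip (A u) v + ip u (A v) =
      ip_plus (G_plus u) (G_plus v) - ip_minus (G_minus u) (G_minus v)"
    and ker: "{x + y | x y. x \<in> D \<and> G_minus x = 0 \<and> y \<in> D \<and> G_plus y = 0} = D"
    using assms(5) unfolding boundary_quadruple_def Let_def D_def A_def by blast+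
  have adj: "v \<in> D \<and> A v = w \<longleftrightarrow> (\<forall>u\<in>D0. ip (A0 u) v + ip u w = 0)" for v w
  proof -
    have "A v = w \<longleftrightarrow> adjoint_op ip D0 A0 v = - w" by (auto simp: A_def)
    then show ?thesis
      using adjoint_iff[OF assms(3), of v A0 "- w"] by (simp add: D_def eq_neg_iff_add_eq_0)
  qed
  \<comment> \<open>Skew-symmetry is exactly the condition \<open>adj\<close> for
    \<open>v = m\<close> and \<open>w = A0 m\<close>, so \<open>A\<close> extends
    \<open>A0\<close>.\<close>
  have A0: "m \<in> D \<and> A m = A0 m" if "m \<in> D0" for m
    using assms(4) that by (simp add: adj skew_symmetric_def)
  have A_eq: "A m = A0 m" if "m \<in> D0" for m
    using A0[OF that] by blast
  have graph: "v \<in> D \<and> A v = w \<longleftrightarrow> (\<forall>m\<in>D0. ip (A m) v + ip m w = 0)" for v w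
    unfolding adj using A_eq by simp
  have sub: "D0 \<subseteq> D"
    using A0 by blast
  have ker': "{x + y | x y. x \<in> D \<and> G_plus x = 0 \<and> y \<in> D \<and> G_minus y = 0} = D"
    by (subst ker[symmetric], rule Collect_cong) (metis add.commute)
  have plus: "skew_boundary scl ip scl_minus ip_minus scl_plus ip_plus D0 D A G_minus G_plus"
    by (intro skew_boundary.intro skew_boundary_axioms.intro; (fact | rule graph | rule green; assumption))
  \<comment> \<open>The graph condition for \<open>- A\<close> with value \<open>w\<close> is the
    negative of the one for \<open>A\<close> with value \<open>- w\<close>. Together with the sign
    change in \<open>green'\<close> this gives the same setting with the boundary spaces
    interchanged.\<close>
  have graph': "v \<in> D \<and> - A v = w \<longleftrightarrow> (\<forall>m\<in>D0. ip (- A m) v + ip m w = 0)" for v w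
  proof -
    have "- A v = w \<longleftrightarrow> A v = - w" by auto
    moreover have "ip (- A m) v + ip m w = - (ip (A m) v + ip m (- w))" for m by simp
    ultimately show ?thesis
      using graph[of v "- w"] by (simp only: neg_equal_0_iff_equal)
  qed
  have green': "ip (- A u) v + ip u (- A v) =
      ip_minus (G_minus u) (G_minus v) - ip_plus (G_plus u) (G_plus v)" if "u \<in> D" "v \<in> D" for u v
    using green[OF that] by (simp add: algebra_simps)
  have minus: "skew_boundary scl ip scl_plus ip_plus scl_minus ip_minus D0 D (\<lambda>u. - A u) G_plus G_minus"
    by (intro skew_boundary.intro skew_boundary_axioms.intro; (fact | rule graph' | rule green'; assumption))
  show ?thesis
    using skew_boundary.mcomplete_plus[OF plus] skew_boundary.mcomplete_plus[OF minus] by blast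
qed

end
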